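(* There exists an absolute constant $C>0$ such that for any $b,h\in[0,1]$, $K\ge 0$, $L\in\mathbb{Z}_{\ge 0}$, $U>0$, $T\in\mathbb{Z}_{>0}$, any probability distribution $\mathcal{D}$ on $[0,U]^{T+L}$, and any $N\in\mathbb{Z}_{>0}$, taking $\Pi_S=\{S:S\in[0,H]\}$ with $H=(L+1)U$, $$\mathbb{E}_{\mathbf{d}_1,\dots,\mathbf{d}_N\sim\mathcal{D}}\big[\mathrm{EE}(\mathcal{L}(\Pi_S))\big]\le \mathbb{E}_{\mathbf{d}_1,\dots,\mathbf{d}_N\sim\mathcal{D}}\big[\mathrm{GE}(\mathcal{L}(\Pi_S))\big]\le C\,\big((L+1)U+K\big)\sqrt{\frac1N}.$$
   Context: Inventory model (backlogged demand, lead time $L$). There are $T+L$ periods; a demand sequence is $\mathbf{d}=(d^1,\dots,d^{T+L})\in[0,U]^{T+L}$. Let $x^t$ be the inventory level at the beginning of period $t$ and $q^t\ge 0$ the quantity ordered in period $t$ (arriving in period $t+L$), with $q^t=0$ for $t\le 0$. The inventory position before ordering is $I^t=x^t+\sum_{t'=t-L}^{t-1}q^{t'}$. After replenishment the inventory level is $y^t=x^t+q^{t-L}$, and $x^{t+1}=y^t-d^t$. The initial level $x^1\le 0$ is a fixed constant. Let $c(x)=h\max\{x,0\}+b\max\{-x,0\}$. The loss in period $t$ of a policy $\pi$ is $\ell^t(\pi,\mathbf{d})=c(y^t-d^t)+K\cdot\mathbb{I}\{q^{t-L}>0\}$, and the loss is $\ell(\pi,\mathbf{d})=\frac1T\sum_{t=L+1}^{T+L}\ell^t(\pi,\mathbf{d})$.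 Stationary base-stock policies: $\Pi_S=\{S:S\in[0,H]\}$; the policy $S$ orders $q^t=\max\{S-I^t,0\}$ in every period $t\ge1$. Errors: $\mathbf{d}_1,\dots,\mathbf{d}_N$ are i.i.d. from $\mathcal{D}$; $\mathcal{L}(\Pi)=\{\ell(\pi,\cdot):\pi\in\Pi\}$; $R(\pi)=\mathbb{E}_{\mathbf{d}\sim\mathcal{D}}[\ell(\pi,\mathbf{d})]$; $\hat R(\pi)=\frac1N\sum_{i=1}^N\ell(\pi,\mathbf{d}_i)$. The generalization error is $\mathrm{GE}(\mathcal{L}(\Pi))=\sup_{\pi\in\Pi}\{R(\pi)-\hat R(\pi)\}$. The estimation error is $\mathrm{EE}(\mathcal{L}(\Pi))=R(\hat\pi)-R(\pi^* )$, where $\hat\pi\in\arg\inf_{\pi\in\Pi}\hat R(\pi)$ and $\pi^*\in\arg\inf_{\pi\in\Pi}R(\pi)$ (minimizers presumed to exist). *)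

theory Defs
  imports "HOL-Probability.Probability"
begin

text \<open>
  A policy maps the period and the inventory position before ordering to an order quantity;
  a demand sequence assigns to each period \<open>1, 2, \<dots>\<close> its demand.
\<close>

type_synonym policy = "nat \<Rightarrow> real \<Rightarrow> real"
type_synonym demand = "nat \<Rightarrow> real"

text \<open>
  For lead time \<open>L\<close> and initial level \<open>x1\<close>, the inventory level \<open>x\<^sup>t\<close>, inventory position
  \<open>I\<^sup>t\<close> and order quantity \<open>q\<^sup>t\<close>.  Periods start at 1.  Since \<open>order_quantity\<close> vanishes at 0
  and subtraction on naturals truncates at 0, the terms with index \<open>t - L\<close> realise the
  convention that \<open>q\<^sup>t = 0\<close> for \<open>t \<le> 0\<close>.  The values of level and position at period 0 play no role.
\<close>

function
  inventory_level :: "nat \<Rightarrow> real \<Rightarrow> policy \<Rightarrow> demand \<Rightarrow> nat \<Rightarrow> real" and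
  inventory_position :: "nat \<Rightarrow> real \<Rightarrow> policy \<Rightarrow> demand \<Rightarrow> nat \<Rightarrow> real" and
  order_quantity :: "nat \<Rightarrow> real \<Rightarrow> policy \<Rightarrow> demand \<Rightarrow> nat \<Rightarrow> real"
where
  "inventory_level L x1 \<pi> d 0 = x1"
| "inventory_level L x1 \<pi> d (Suc 0) = x1"
| "inventory_level L x1 \<pi> d (Suc (Suc t)) =
     inventory_level L x1 \<pi> d (Suc t) + order_quantity L x1 \<pi> d (Suc t - L) - d (Suc t)"
| "inventory_position L x1 \<pi> d t =
     inventory_level L x1 \<pi> d t + (\<Sum>s\<in>{t - L..<t}. order_quantity L x1 \<pi> d s)"
| "order_quantity L x1 \<pi> d 0 = 0"
| "order_quantity L x1 \<pi> d (Suc t) = \<pi> (Suc t) (inventory_position L x1 \<pi> d (Suc t))"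
  by pat_completeness auto
termination
  by (relation "Wellfounded.measure (\<lambda>a. case a of
        Inl (L, x1, \<pi>, d, t) \<Rightarrow> 3 * t
      | Inr (Inl (L, x1, \<pi>, d, t)) \<Rightarrow> 3 * t + 1
      | Inr (Inr (L, x1, \<pi>, d, t)) \<Rightarrow> 3 * t + 2)") auto

definition replenished_level :: "nat \<Rightarrow> real \<Rightarrow> policy \<Rightarrow> demand \<Rightarrow> nat \<Rightarrow> real" where
  "replenished_level L x1 \<pi> d t = inventory_level L x1 \<pi> d t + order_quantity L x1 \<pi> d (t - L)"

definition inventory_cost :: "real \<Rightarrow> real \<Rightarrow> real \<Rightarrow> real" where
  "inventory_cost b h x = h * max x 0 + b * max (- x) 0"

definition period_loss ::
  "real \<Rightarrow> real \<Rightarrow> real \<Rightarrow> nat \<Rightarrow> real \<Rightarrow> policy \<Rightarrow> demand \<Rightarrow> nat \<Rightarrow> real" where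
  "period_loss b h K L x1 \<pi> d t =
     inventory_cost b h (replenished_level L x1 \<pi> d t - d t)
     + K * of_bool (order_quantity L x1 \<pi> d (t - L) > 0)"

definition loss ::
  "real \<Rightarrow> real \<Rightarrow> real \<Rightarrow> nat \<Rightarrow> nat \<Rightarrow> real \<Rightarrow> policy \<Rightarrow> demand \<Rightarrow> real" where
  "loss b h K L T x1 \<pi> d = (\<Sum>t = L + 1..T + L. period_loss b h K L x1 \<pi> d t) / real T"

definition base_stock :: "real \<Rightarrow> policy" where
  "base_stock S = (\<lambda>t I. max (S - I) 0)"

definition base_stock_policies :: "real \<Rightarrow> policy set" where
  "base_stock_policies H = base_stock ` {0..H}"

definition demand_space :: "real \<Rightarrow> nat \<Rightarrow> demand measure" where
  "demand_space U n = (\<Pi>\<^sub>M t\<in>{1..n}. restrict_space borel {0..U})"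

definition iid_samples :: "nat \<Rightarrow> 'd measure \<Rightarrow> (nat \<Rightarrow> 'd) measure" where
  "iid_samples N D = (\<Pi>\<^sub>M i\<in>{1..N}. D)"

definition risk :: "'d measure \<Rightarrow> ('p \<Rightarrow> 'd \<Rightarrow> real) \<Rightarrow> 'p \<Rightarrow> real" where
  "risk D l \<pi> = (\<integral>d. l \<pi> d \<partial>D)"

definition empirical_risk :: "nat \<Rightarrow> (nat \<Rightarrow> 'd) \<Rightarrow> ('p \<Rightarrow> 'd \<Rightarrow> real) \<Rightarrow> 'p \<Rightarrow> real" where
  "empirical_risk N ds l \<pi> = (\<Sum>i = 1..N. l \<pi> (ds i)) / real N"

definition generalization_error ::
  "'d measure \<Rightarrow> nat \<Rightarrow> ('p \<Rightarrow> 'd \<Rightarrow> real) \<Rightarrow> 'p set \<Rightarrow> (nat \<Rightarrow> 'd) \<Rightarrow> real" where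
  "generalization_error D N l P ds = (SUP \<pi>\<in>P. risk D l \<pi> - empirical_risk N ds l \<pi>)"

definition estimation_error :: "'d measure \<Rightarrow> ('p \<Rightarrow> 'd \<Rightarrow> real) \<Rightarrow> 'p \<Rightarrow> 'p \<Rightarrow> real" where
  "estimation_error D l \<pi>_hat \<pi>_star = risk D l \<pi>_hat - risk D l \<pi>_star"

end

theory Submission
  imports Defs
begin

text \<open>
  Under a base-stock policy every order after period 1 equals the previous demand, so the loss is
  a term that is 1-Lipschitz in \<open>S\<close> plus the fixed cost of the first order, which is
  deterministic and cancels in the difference \<open>R - R\<^sub>N\<close> of risk and empirical risk.  For a Lipschitz family on \<open>[0, H]\<close> the
  supremum of \<open>R - R\<^sub>N\<close> is at most, up to \<open>2H/N\<close>, its absolute value at 0 plus the sum of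
  the absolute values of its \<open>N\<close> increments along a grid of step \<open>H/N\<close>.  By the variance
  bound the expectations of these are at most \<open>(H + K)/\<surd>N\<close> and \<open>(H/N)/\<surd>N\<close> each.
\<close>

section \<open>Means of independent samples\<close>

lemma prob_space_iid_samples: "prob_space D \<Longrightarrow> prob_space (iid_samples N D)"
  unfolding iid_samples_def by (rule prob_space_PiM)

lemma iid_samples_in_space:
  "ds \<in> space (iid_samples N D) \<Longrightarrow> i \<in> {1..N} \<Longrightarrow> ds i \<in> space D"
  unfolding iid_samples_def by (auto simp: space_PiM)

lemma measurable_iid_samples:
  "f \<in> borel_measurable D \<Longrightarrow> i \<in> {1..N} \<Longrightarrow> (\<lambda>ds. f (ds i)) \<in> borel_measurable (iid_samples N D)"
  unfolding iid_samples_def by (rule measurable_PiM_component_rev)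

lemma (in finite_measure) integrable_bounded_on_space:
  fixes f :: "'a \<Rightarrow> real"
  assumes "f \<in> borel_measurable M" "\<And>x. x \<in> space M \<Longrightarrow> \<bar>f x\<bar> \<le> B"
  shows "integrable M f"
  using assms by (intro integrable_const_bound[of _ B]) (auto intro!: AE_I2)

lemma (in prob_space) integral_iid_samples_component:
  fixes f :: "'a \<Rightarrow> real"
  assumes "f \<in> borel_measurable M" "i \<in> {1..N}"
  shows "(\<integral>ds. f (ds i) \<partial>iid_samples N M) = expectation f"
proof -
  have "expectation f = integral\<^sup>L (distr (\<Pi>\<^sub>M i\<in>{1..N}. M) M (\<lambda>ds. ds i)) f"
    using assms by (subst distr_PiM_component) (auto intro: prob_space_axioms)
  also have "\<dots> = (\<integral>ds. f (ds i) \<partial>(\<Pi>\<^sub>M i\<in>{1..N}. M))"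
    using assms by (intro integral_distr) (auto intro: measurable_component_singleton)
  finally show ?thesis unfolding iid_samples_def by simp
qed

text \<open>Padding with factors 1 turns the integrand into a product over all \<open>N\<close>
  coordinates, whose integral factorises; in a probability space each padding factor integrates to
  1.\<close>

lemma (in prob_space) integral_iid_samples_product:
  fixes f :: "'a \<Rightarrow> real"
  assumes "integrable M f" "i \<in> {1..N}" "j \<in> {1..N}" "i \<noteq> j"
  shows "(\<integral>ds. f (ds i) * f (ds j) \<partial>iid_samples N M) = (expectation f)\<^sup>2"
proof -
  interpret product_sigma_finite "\<lambda>_::nat. M"
    by standard
  define g where "g = (\<lambda>k x. if k \<in> {i, j} then f x else 1)"
  have two: "(\<Prod>k\<in>{1..N}. if k \<in> {i, j} then a k else 1) = a i * a j" for a :: "nat \<Rightarrow> real"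
  proof -
    have "(\<Prod>k\<in>{1..N}. if k \<in> {i, j} then a k else 1) = (\<Prod>k\<in>{1..N} \<inter> {i, j}. a k)"
      by (subst prod.inter_restrict) auto
    also have "{1..N} \<inter> {i, j} = {i, j}" using assms by auto
    finally show ?thesis using assms by simp
  qed
  have "(\<integral>ds. (\<Prod>k\<in>{1..N}. g k (ds k)) \<partial>(\<Pi>\<^sub>M k\<in>{1..N}. M)) = (\<Prod>k\<in>{1..N}. integral\<^sup>L M (g k))"
  proof (rule product_integral_prod)
    show "integrable M (g k)" for k
      using assms by (cases "k \<in> {i, j}") (simp_all add: g_def)
  qed simp
  moreover have "(\<Prod>k\<in>{1..N}. g k (ds k)) = f (ds i) * f (ds j)" for ds
    unfolding g_def by (rule two)
  moreover have "(\<Prod>k\<in>{1..N}. integral\<^sup>L M (g k)) = (expectation f)\<^sup>2"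
  proof -
    have "integral\<^sup>L M (g k) = (if k \<in> {i, j} then expectation f else 1)" for k
      by (simp add: g_def prob_space)
    then show ?thesis using two[of "\<lambda>_. expectation f"] by (simp add: power2_eq_square)
  qed
  ultimately show ?thesis unfolding iid_samples_def by simp
qed

text \<open>The variance of \<open>\<bar>f\<bar>\<close> is nonnegative, and squaring forgets the
  absolute value.\<close>

lemma (in prob_space) expectation_abs_le_sqrt:
  fixes f :: "'a \<Rightarrow> real"
  assumes "integrable M f" "integrable M (\<lambda>x. (f x)\<^sup>2)"
  shows "expectation (\<lambda>x. \<bar>f x\<bar>) \<le> sqrt (expectation (\<lambda>x. (f x)\<^sup>2))"
proof -
  have "0 \<le> variance (\<lambda>x. \<bar>f x\<bar>)" by (rule variance_positive)
  also have "\<dots> = expectation (\<lambda>x. (f x)\<^sup>2) - (expectation (\<lambda>x. \<bar>f x\<bar>))\<^sup>2"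
    using assms by (subst variance_eq) auto
  finally show ?thesis by (intro real_le_rsqrt) simp
qed

text \<open>Independence removes the cross terms from the second moment of \<open>dev\<close>,
  leaving the variance of \<open>f\<close> divided by \<open>N\<close>; the first absolute moment is
  at most the root of the second.\<close>

lemma (in prob_space) expectation_deviation_le:
  fixes f :: "'a \<Rightarrow> real"
  assumes f[measurable]: "f \<in> borel_measurable M"
    and bound: "\<And>x. x \<in> space M \<Longrightarrow> \<bar>f x\<bar> \<le> B" and N: "N > 0"
  defines "dev \<equiv> \<lambda>ds. expectation f - (\<Sum>i=1..N. f (ds i)) / real N"
  shows "integrable (iid_samples N M) dev"
    and "(\<integral>ds. dev ds \<partial>iid_samples N M) = 0"
    and "(\<integral>ds. \<bar>dev ds\<bar> \<partial>iid_samples N M) \<le> B * sqrt (1 / real N)"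
proof -
  let ?M = "iid_samples N M"
  interpret P: prob_space ?M by (intro prob_space_iid_samples prob_space_axioms)
  have int_f: "integrable M f" using bound by (intro integrable_bounded_on_space) auto
  have B: "0 \<le> B"
  proof -
    obtain x where "x \<in> space M" using not_empty by blast
    then show ?thesis using bound[of x] by linarith
  qed
  have int_comp: "integrable ?M (\<lambda>ds. f (ds i))" if "i \<in> {1..N}" for i
    using that bound iid_samples_in_space[of _ N M]
    by (intro P.integrable_bounded_on_space measurable_iid_samples) auto
  show int_dev: "integrable ?M dev"
    unfolding dev_def using int_comp
    by (intro Bochner_Integration.integrable_diff integrable_divide Bochner_Integration.integrable_sum) auto
  have "(\<integral>ds. dev ds \<partial>?M)
      = (\<integral>ds. expectation f \<partial>?M) - (\<integral>ds. (\<Sum>i=1..N. f (ds i)) / real N \<partial>?M)"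
    unfolding dev_def
    by (intro Bochner_Integration.integral_diff integrable_divide Bochner_Integration.integrable_sum int_comp)
      simp_all
  also have "\<dots> = expectation f - (\<Sum>i=1..N. (\<integral>ds. f (ds i) \<partial>?M)) / real N"
    using Bochner_Integration.integral_sum[OF int_comp, of "{1..N}" "\<lambda>i. i"]
    by (simp add: P.prob_space)
  also have "\<dots> = 0"
    using N by (simp add: integral_iid_samples_component)
  finally show mean_dev: "(\<integral>ds. dev ds \<partial>?M) = 0" .
  \<comment> \<open>Centring makes the expectation of each off-diagonal product vanish, since it is
    the square of \<open>expectation g\<close>.\<close>
  define g where "g = (\<lambda>x. f x - expectation f)"
  have g[measurable]: "g \<in> borel_measurable M" unfolding g_def by simp
  have int_g: "integrable M g" unfolding g_def using int_f by simp
  have mean_g: "expectation g = 0" unfolding g_def using int_f by (simp add: prob_space)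
  have int_f2: "integrable M (\<lambda>x. (f x)\<^sup>2)"
    using bound by (intro integrable_bounded_on_space[where B = "B\<^sup>2"])
      (auto simp: B abs_le_square_iff[symmetric])
  \<comment> \<open>Dropping the squared mean keeps the constant at \<open>B\<close>; estimating
    \<open>g\<close> pointwise by \<open>2 * B\<close> would double it.\<close>
  have var_le: "expectation (\<lambda>x. (g x)\<^sup>2) \<le> B\<^sup>2"
  proof -
    have "expectation (\<lambda>x. (g x)\<^sup>2) = expectation (\<lambda>x. (f x)\<^sup>2) - (expectation f)\<^sup>2"
      unfolding g_def using variance_eq[OF int_f int_f2] .
    also have "\<dots> \<le> expectation (\<lambda>x. (f x)\<^sup>2)" by simp
    also have "\<dots> \<le> expectation (\<lambda>x. B\<^sup>2)"
      using bound B by (intro integral_mono int_f2) (auto simp: abs_le_square_iff[symmetric])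
    finally show ?thesis by (simp add: prob_space)
  qed
  \<comment> \<open>This cruder bound serves only the integrability of the products.\<close>
  have g_bound: "\<bar>g x\<bar> \<le> B + \<bar>expectation f\<bar>" if "x \<in> space M" for x
    using bound[OF that] unfolding g_def by linarith
  have int_gg: "integrable ?M (\<lambda>ds. g (ds i) * g (ds j))" if "i \<in> {1..N}" "j \<in> {1..N}" for i j
  proof (rule P.integrable_bounded_on_space)
    show "(\<lambda>ds. g (ds i) * g (ds j)) \<in> borel_measurable ?M"
      using that by (intro borel_measurable_times measurable_iid_samples g)
    fix ds assume "ds \<in> space ?M"
    then show "\<bar>g (ds i) * g (ds j)\<bar> \<le> (B + \<bar>expectation f\<bar>) * (B + \<bar>expectation f\<bar>)"
      unfolding abs_mult using that B iid_samples_in_space[of ds N M]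
      by (intro mult_mono g_bound) auto
  qed
  have dev_g: "(dev ds)\<^sup>2 = (\<Sum>i=1..N. \<Sum>j=1..N. g (ds i) * g (ds j)) / (real N)\<^sup>2" for ds
  proof -
    have "dev ds = - (\<Sum>i=1..N. g (ds i)) / real N"
      using N by (simp add: dev_def g_def sum_subtractf field_simps)
    then show ?thesis by (simp add: power2_eq_square sum_product)
  qed
  have "(\<integral>ds. (dev ds)\<^sup>2 \<partial>?M)
      = (\<Sum>i=1..N. \<Sum>j=1..N. (\<integral>ds. g (ds i) * g (ds j) \<partial>?M)) / (real N)\<^sup>2"
  proof -
    have "(\<integral>ds. (\<Sum>i=1..N. \<Sum>j=1..N. g (ds i) * g (ds j)) \<partial>?M)
        = (\<Sum>i=1..N. (\<integral>ds. (\<Sum>j=1..N. g (ds i) * g (ds j)) \<partial>?M))"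
      by (intro Bochner_Integration.integral_sum Bochner_Integration.integrable_sum int_gg)
    also have "\<dots> = (\<Sum>i=1..N. \<Sum>j=1..N. (\<integral>ds. g (ds i) * g (ds j) \<partial>?M))"
      by (intro sum.cong refl Bochner_Integration.integral_sum int_gg)
    finally show ?thesis unfolding dev_g by simp
  qed
  \<comment> \<open>Only the \<open>N\<close> diagonal terms survive, so the division by the square
    of \<open>N\<close> leaves a factor \<open>1 / N\<close>.\<close>
  also have "\<dots> = (\<Sum>i=1..N. \<Sum>j=1..N. if j = i then expectation (\<lambda>x. (g x)\<^sup>2) else 0) / (real N)\<^sup>2"
  proof (intro arg_cong2[where f = "(/)"] sum.cong refl)
    fix i j assume ij: "i \<in> {1..N}" "j \<in> {1..N}"
    show "(\<integral>ds. g (ds i) * g (ds j) \<partial>?M) = (if j = i then expectation (\<lambda>x. (g x)\<^sup>2) else 0)"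
    proof (cases "j = i")
      case True
      then show ?thesis
        using ij integral_iid_samples_component[of "\<lambda>x. (g x)\<^sup>2" i N] by (simp add: power2_eq_square)
    next
      case False
      then show ?thesis
        using ij integral_iid_samples_product[OF int_g, of i N j] mean_g by auto
    qed
  qed
  also have "\<dots> = expectation (\<lambda>x. (g x)\<^sup>2) / real N"
    using N by (simp add: power2_eq_square)
  also have "\<dots> \<le> B\<^sup>2 / real N" using var_le by (intro divide_right_mono) auto
  finally have second: "(\<integral>ds. (dev ds)\<^sup>2 \<partial>?M) \<le> B\<^sup>2 / real N" .
  have "integrable ?M (\<lambda>ds. (dev ds)\<^sup>2)"
    unfolding dev_g by (intro integrable_divide Bochner_Integration.integrable_sum int_gg)
  with int_dev have "(\<integral>ds. \<bar>dev ds\<bar> \<partial>?M) \<le> sqrt (\<integral>ds. (dev ds)\<^sup>2 \<partial>?M)"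
    by (rule P.expectation_abs_le_sqrt)
  also have "\<dots> \<le> sqrt (B\<^sup>2 / real N)" using second by simp
  also have "\<dots> = B * sqrt (1 / real N)" using B by (simp add: real_sqrt_divide)
  finally show "(\<integral>ds. \<bar>dev ds\<bar> \<partial>?M) \<le> B * sqrt (1 / real N)" .
qed

section \<open>Losses that are Lipschitz in a scalar parameter\<close>

lemma abs_diff_triangle: "\<bar>(a - b) - (a' - b')\<bar> \<le> \<bar>a - a'\<bar> + \<bar>b - b'\<bar>" for a :: real
  by linarith

section \<open>Uniform grids in an interval\<close>

lemma grid_point_in_interval:
  fixes H :: real
  assumes "0 \<le> H" "j \<le> m"
  shows "real j * H / real m \<in> {0..H}"
proof -
  have "real j / real m \<le> 1" using assms by (simp add: divide_simps)
  from mult_right_mono[OF this, of H] show ?thesis using assms by simp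
qed

lemma exists_near_grid_point:
  fixes S H :: real
  assumes "S \<in> {0..H}" "m > 0"
  shows "\<exists>j\<le>m. \<bar>S - real j * H / real m\<bar> \<le> H / real m"
proof (cases "H = 0")
  case True
  with assms show ?thesis by auto
next
  case False
  with assms have H: "H > 0" by auto
  \<comment> \<open>\<open>a\<close> is the position of \<open>S\<close> in units of the grid step
    \<open>H / m\<close>; rounding it down keeps the index at most \<open>m\<close>.\<close>
  define a where "a = S * real m / H"
  have a: "0 \<le> a" "a \<le> real m" using assms H by (auto simp: a_def field_simps mult_right_mono)
  define j where "j = nat \<lfloor>a\<rfloor>"
  have j: "real j \<le> a" "a \<le> real j + 1" using a by (auto simp: j_def)
  have "j \<le> m" using j a by linarith
  moreover have "S - real j * H / real m = (a - real j) * (H / real m)"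
    using assms H by (simp add: a_def field_simps)
  moreover have "\<bar>(a - real j) * (H / real m)\<bar> \<le> 1 * (H / real m)"
    unfolding abs_mult using j H by (intro mult_mono) auto
  ultimately show ?thesis by auto
qed

text \<open>Replaces an uncountable supremum by a countable one, so that its measurability can be
  shown. \<open>G\<close> contains the grids of every mesh, so each point lies within
  \<open>H / m\<close> of \<open>G\<close> for every \<open>m\<close>, and the Lipschitz error
  vanishes as \<open>m\<close> grows.\<close>

lemma cSUP_Lipschitz_eq_cSUP_grid:
  fixes f :: "real \<Rightarrow> real"
  assumes H: "0 \<le> H"
    and lip: "\<And>s t. s \<in> {0..H} \<Longrightarrow> t \<in> {0..H} \<Longrightarrow> \<bar>f s - f t\<bar> \<le> c * \<bar>s - t\<bar>"
  defines "G \<equiv> {real j * H / real m | j m. m > 0 \<and> j \<le> m}"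
  shows "(SUP s\<in>{0..H}. f s) = (SUP s\<in>G. f s)"
proof (rule antisym)
  have G: "G \<subseteq> {0..H}" "0 \<in> G"
  proof -
    show "G \<subseteq> {0..H}" unfolding G_def using grid_point_in_interval[OF H] by blast
    have "real 0 * H / real 1 \<in> G" unfolding G_def by (intro CollectI exI[of _ 0] exI[of _ 1]) simp
    then show "0 \<in> G" by simp
  qed
  have bdd: "bdd_above (f ` {0..H})"
  proof (rule bdd_aboveI2)
    fix s assume s: "s \<in> {0..H}"
    have "c * \<bar>s - 0\<bar> \<le> \<bar>c\<bar> * H" using s by (intro mult_mono) auto
    then show "f s \<le> f 0 + \<bar>c\<bar> * H" using lip[of s 0] s H by auto
  qed
  then have bddG: "bdd_above (f ` G)" using G by (meson bdd_above_mono image_mono)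
  show "(SUP s\<in>G. f s) \<le> (SUP s\<in>{0..H}. f s)"
    using G(2) by (intro cSUP_subset_mono[OF _ bdd G(1)]) auto
  show "(SUP s\<in>{0..H}. f s) \<le> (SUP s\<in>G. f s)"
  proof (rule cSUP_least)
    fix s assume s: "s \<in> {0..H}"
    \<comment> \<open>\<open>\<bar>c\<bar>\<close> makes the estimate valid for either sign of
      \<open>c\<close>, and \<open>Suc m\<close> avoids division by 0.\<close>
    have le: "f s \<le> (SUP s\<in>G. f s) + \<bar>c\<bar> * H / real (Suc m)" for m
    proof -
      obtain j where j: "j \<le> Suc m" "\<bar>s - real j * H / real (Suc m)\<bar> \<le> H / real (Suc m)"
        using exists_near_grid_point[OF s, of "Suc m"] by auto
      let ?t = "real j * H / real (Suc m)"
      have t: "?t \<in> G" unfolding G_def using j by blast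
      have "f s - f ?t \<le> c * \<bar>s - ?t\<bar>" using lip[OF s, of ?t] t G by auto
      also have "\<dots> \<le> \<bar>c\<bar> * (H / real (Suc m))" using j by (intro mult_mono) auto
      finally show ?thesis using cSUP_upper[OF t bddG] by simp
    qed
    have lim: "(\<lambda>m. (SUP s\<in>G. f s) + \<bar>c\<bar> * H / real (Suc m)) \<longlonglongrightarrow> (SUP s\<in>G. f s) + 0"
      by (intro tendsto_add tendsto_const LIMSEQ_Suc lim_const_over_n)
    have "f s \<le> (SUP s\<in>G. f s) + 0"
      by (rule LIMSEQ_le_const[OF lim]) (use le in blast)
    then show "f s \<le> (SUP s\<in>G. f s)" by simp
  qed (use H in auto)
qed

text \<open>Chaining at a single scale: the start at 0 contributes \<open>B\<close>, the
  \<open>N\<close> grid increments together \<open>H\<close>, and rounding to the grid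
  \<open>2 * H\<close>, each times \<open>sqrt (1 / real N)\<close>. The other conclusions prepare
  the comparison of estimation and generalization error.\<close>

lemma (in prob_space) expectation_sup_deviation_le:
  fixes F :: "real \<Rightarrow> 'a \<Rightarrow> real"
  assumes H: "H > 0" and N: "N > 0"
    and meas: "\<And>S. S \<in> {0..H} \<Longrightarrow> F S \<in> borel_measurable M"
    and bound0: "\<And>x. x \<in> space M \<Longrightarrow> \<bar>F 0 x\<bar> \<le> B"
    and lip: "\<And>S S' x. S \<in> {0..H} \<Longrightarrow> S' \<in> {0..H} \<Longrightarrow> x \<in> space M \<Longrightarrow>
        \<bar>F S x - F S' x\<bar> \<le> \<bar>S - S'\<bar>"
  defines "Z \<equiv> \<lambda>S ds. expectation (F S) - (\<Sum>i=1..N. F S (ds i)) / real N"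
  shows "integrable (iid_samples N M) (\<lambda>ds. SUP S\<in>{0..H}. Z S ds)"
    and "\<And>ds. ds \<in> space (iid_samples N M) \<Longrightarrow> bdd_above ((\<lambda>S. Z S ds) ` {0..H})"
    and "\<And>S. S \<in> {0..H} \<Longrightarrow> integrable (iid_samples N M) (Z S)"
    and "\<And>S. S \<in> {0..H} \<Longrightarrow> (\<integral>ds. Z S ds \<partial>iid_samples N M) = 0"
    and "(\<integral>ds. (SUP S\<in>{0..H}. Z S ds) \<partial>iid_samples N M) \<le> (B + 3 * H) * sqrt (1 / real N)"
proof -
  let ?M = "iid_samples N M"
  let ?G = "{real j * H / real m | j m. m > 0 \<and> j \<le> m}"
  interpret P: prob_space ?M by (intro prob_space_iid_samples prob_space_axioms)
  have bound: "\<bar>F S x\<bar> \<le> B + H" if "S \<in> {0..H}" "x \<in> space M" for S x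
    using lip[of S 0 x] bound0[of x] that H by auto
  have int: "integrable M (F S)" if "S \<in> {0..H}" for S
    using that bound meas by (intro integrable_bounded_on_space[where B = "B + H"]) auto
  have mean_lip: "\<bar>expectation (F S) - expectation (F S')\<bar> \<le> \<bar>S - S'\<bar>"
    if "S \<in> {0..H}" "S' \<in> {0..H}" for S S'
  proof -
    have "\<bar>expectation (F S) - expectation (F S')\<bar> = \<bar>expectation (\<lambda>x. F S x - F S' x)\<bar>"
      using int that by simp
    also have "\<dots> \<le> expectation (\<lambda>x. \<bar>F S x - F S' x\<bar>)" by (rule integral_abs_bound)
    also have "\<dots> \<le> expectation (\<lambda>x. \<bar>S - S'\<bar>)"
      using int that lip by (intro integral_mono) auto
    finally show ?thesis by (simp add: prob_space)
  qed
  \<comment> \<open>The factor 2 counts one Lipschitz constant for the expectation and one for the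
    sample average.\<close>
  have Z_lip: "\<bar>Z S ds - Z S' ds\<bar> \<le> 2 * \<bar>S - S'\<bar>"
    if "S \<in> {0..H}" "S' \<in> {0..H}" "ds \<in> space ?M" for S S' ds
  proof -
    have "\<bar>\<Sum>i=1..N. F S (ds i) - F S' (ds i)\<bar> \<le> (\<Sum>i=1..N. \<bar>S - S'\<bar>)"
      using that lip iid_samples_in_space[of ds N M]
      by (intro order_trans[OF sum_abs] sum_mono) auto
    then have "\<bar>(\<Sum>i=1..N. F S (ds i)) / real N - (\<Sum>i=1..N. F S' (ds i)) / real N\<bar> \<le> \<bar>S - S'\<bar>"
      using N by (simp add: sum_subtractf diff_divide_distrib[symmetric] field_simps)
    with mean_lip[OF that(1,2)] have
      "\<bar>expectation (F S) - expectation (F S')\<bar>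
        + \<bar>(\<Sum>i=1..N. F S (ds i)) / real N - (\<Sum>i=1..N. F S' (ds i)) / real N\<bar> \<le> 2 * \<bar>S - S'\<bar>"
      by simp
    then show ?thesis
      unfolding Z_def by (rule order_trans[OF abs_diff_triangle])
  qed
  have dev: "integrable ?M (Z S)" "(\<integral>ds. Z S ds \<partial>?M) = 0" if "S \<in> {0..H}" for S
    unfolding Z_def
    using expectation_deviation_le(1,2)[OF meas[OF that] bound[OF that] N] by auto
  show "integrable ?M (Z S)" "(\<integral>ds. Z S ds \<partial>?M) = 0" if "S \<in> {0..H}" for S
    using dev that by auto
  have abs0: "\<bar>Z S ds\<bar> \<le> 2 * (B + H)" if "S \<in> {0..H}" "ds \<in> space ?M" for S ds
  proof -
    have "\<bar>\<Sum>i=1..N. F S (ds i)\<bar> \<le> (\<Sum>i=1..N. B + H)"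
      using that bound iid_samples_in_space[of ds N M]
      by (intro order_trans[OF sum_abs] sum_mono) auto
    then have "\<bar>(\<Sum>i=1..N. F S (ds i)) / real N\<bar> \<le> B + H"
      using N by (simp add: field_simps)
    moreover have "\<bar>expectation (F S)\<bar> \<le> B + H"
    proof -
      have "\<bar>expectation (F S)\<bar> \<le> expectation (\<lambda>x. \<bar>F S x\<bar>)" by (rule integral_abs_bound)
      also have "\<dots> \<le> expectation (\<lambda>x. B + H)"
        using int that bound by (intro integral_mono) auto
      finally show ?thesis by (simp add: prob_space)
    qed
    ultimately show ?thesis
      unfolding Z_def by (intro order_trans[OF abs_triangle_ineq4]) simp
  qed
  show bdd: "bdd_above ((\<lambda>S. Z S ds) ` {0..H})" if "ds \<in> space ?M" for ds
    using abs0 that by (intro bdd_aboveI2[where M = "2 * (B + H)"]) (meson abs_le_D1)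
  have G: "?G \<subseteq> {0..H}"
    using grid_point_in_interval[of H] H by fastforce
  have countable: "countable ?G"
  proof -
    have "?G \<subseteq> (\<lambda>(j, m). real j * H / real m) ` UNIV" by auto
    then show ?thesis by (rule countable_subset) simp
  qed
  have SUP_G: "(SUP S\<in>{0..H}. Z S ds) = (SUP S\<in>?G. Z S ds)" if "ds \<in> space ?M" for ds
    using H Z_lip that by (intro cSUP_Lipschitz_eq_cSUP_grid[where c = 2]) auto
  \<comment> \<open>Over the countable grid the supremum is measurable; \<open>SUP_G\<close> carries
    this over to \<open>{0..H}\<close>.\<close>
  have measG: "(\<lambda>ds. SUP S\<in>?G. Z S ds) \<in> borel_measurable ?M"
  proof (intro borel_measurable_cSUP countable)
    show "Z S \<in> borel_measurable ?M" if "S \<in> ?G" for S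
      using dev(1)[OF subsetD[OF G that]] by (rule borel_measurable_integrable)
    show "bdd_above ((\<lambda>S. Z S ds) ` ?G)" if "ds \<in> space ?M" for ds
      by (rule bdd_above_mono[OF bdd[OF that] image_mono[OF G]])
  qed
  have meas_SUP: "(\<lambda>ds. SUP S\<in>{0..H}. Z S ds) \<in> borel_measurable ?M"
    using measG SUP_G by (subst measurable_cong) auto
  show int_SUP: "integrable ?M (\<lambda>ds. SUP S\<in>{0..H}. Z S ds)"
  proof (rule P.integrable_bounded_on_space[OF meas_SUP])
    fix ds assume ds: "ds \<in> space ?M"
    have "Z 0 ds \<le> (SUP S\<in>{0..H}. Z S ds)" using H bdd[OF ds] by (intro cSUP_upper) auto
    moreover have "(SUP S\<in>{0..H}. Z S ds) \<le> 2 * (B + H)"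
    proof (rule cSUP_least)
      fix S assume "S \<in> {0..H}"
      then show "Z S ds \<le> 2 * (B + H)" using abs0[OF _ ds, of S] by linarith
    qed (use H in auto)
    ultimately show "\<bar>SUP S\<in>{0..H}. Z S ds\<bar> \<le> 2 * (B + H)"
      using abs0[of 0 ds] ds H by auto
  qed
  \<comment> \<open>The mesh \<open>H / N\<close> is fine enough for the rounding error
    \<open>2 * (H / N)\<close> to stay within the rate, while the expected absolute increments still
    add up to at most \<open>H * sqrt (1 / N)\<close>.\<close>
  define s where "s = (\<lambda>j. real j * H / real N)"
  have s: "s j \<in> {0..H}" if "j \<le> N" for j
    unfolding s_def using that H by (intro grid_point_in_interval) auto
  have s0: "s 0 = 0" by (simp add: s_def)
  define Y where "Y = (\<lambda>j ds. Z (s (Suc j)) ds - Z (s j) ds)"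
  \<comment> \<open>Telescope from 0 to a grid point \<open>s k\<close> near \<open>S\<close>;
    extending the sum of absolute values to all \<open>j < N\<close> removes the dependence on
    \<open>S\<close>.\<close>
  have upper: "(SUP S\<in>{0..H}. Z S ds) \<le> \<bar>Z 0 ds\<bar> + (\<Sum>j<N. \<bar>Y j ds\<bar>) + 2 * (H / real N)"
    if ds: "ds \<in> space ?M" for ds
  proof (rule cSUP_least)
    fix S assume S: "S \<in> {0..H}"
    obtain k where k: "k \<le> N" "\<bar>S - s k\<bar> \<le> H / real N"
      using exists_near_grid_point[OF S N] unfolding s_def by blast
    have "Z (s k) ds - Z 0 ds = (\<Sum>j<k. Y j ds)"
      unfolding Y_def by (subst sum_lessThan_telescope) (simp add: s0)
    also have "\<dots> \<le> (\<Sum>j<k. \<bar>Y j ds\<bar>)" by (intro sum_mono) auto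
    also have "\<dots> \<le> (\<Sum>j<N. \<bar>Y j ds\<bar>)" using k by (intro sum_mono2) auto
    finally have "Z (s k) ds - Z 0 ds \<le> (\<Sum>j<N. \<bar>Y j ds\<bar>)" .
    moreover have "\<bar>Z S ds - Z (s k) ds\<bar> \<le> 2 * (H / real N)"
      by (rule order_trans[OF Z_lip[OF S s[OF k(1)] ds]]) (use k(2) in simp)
    then have "Z S ds - Z (s k) ds \<le> 2 * (H / real N)" by (rule abs_le_D1)
    moreover have "Z 0 ds \<le> \<bar>Z 0 ds\<bar>" by simp
    ultimately show "Z S ds \<le> \<bar>Z 0 ds\<bar> + (\<Sum>j<N. \<bar>Y j ds\<bar>) + 2 * (H / real N)"
      by argo
  qed (use H in auto)
  have intY: "integrable ?M (Y j)" if "j < N" for j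
    unfolding Y_def using dev(1)[OF s, of j] dev(1)[OF s, of "Suc j"] that by simp
  have Y_le: "(\<integral>ds. \<bar>Y j ds\<bar> \<partial>?M) \<le> (H / real N) * sqrt (1 / real N)" if j: "j < N" for j
  proof -
    have sj: "s j \<in> {0..H}" "s (Suc j) \<in> {0..H}" using s j by auto
    define f where "f = (\<lambda>x. F (s (Suc j)) x - F (s j) x)"
    have f: "f \<in> borel_measurable M" unfolding f_def using meas sj by (intro borel_measurable_diff)
    have f_le: "\<bar>f x\<bar> \<le> H / real N" if "x \<in> space M" for x
    proof -
      have "\<bar>f x\<bar> \<le> \<bar>s (Suc j) - s j\<bar>" unfolding f_def using lip sj that by blast
      also have "s (Suc j) - s j = H / real N" using N by (simp add: s_def field_simps)
      finally show ?thesis using H by simp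
    qed
    \<comment> \<open>An increment of \<open>Z\<close> is itself a deviation, of a function bounded
      by \<open>H / real N\<close>, so the variance bound applies with this bound in place of
      \<open>B\<close>.\<close>
    have "Y j ds = expectation f - (\<Sum>i=1..N. f (ds i)) / real N" for ds
      using int sj by (simp add: Y_def Z_def f_def sum_subtractf diff_divide_distrib)
    then show ?thesis using expectation_deviation_le(3)[OF f f_le N] by simp
  qed
  have int0: "integrable ?M (\<lambda>ds. \<bar>Z 0 ds\<bar>)" using dev(1)[of 0] H by simp
  have intY_abs: "integrable ?M (\<lambda>ds. \<bar>Y j ds\<bar>)" if "j \<in> {..<N}" for j
    using intY[of j] that by simp
  have int_sum: "integrable ?M (\<lambda>ds. \<Sum>j<N. \<bar>Y j ds\<bar>)"
    by (intro Bochner_Integration.integrable_sum intY_abs)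
  have "(\<integral>ds. (SUP S\<in>{0..H}. Z S ds) \<partial>?M)
      \<le> (\<integral>ds. \<bar>Z 0 ds\<bar> + (\<Sum>j<N. \<bar>Y j ds\<bar>) + 2 * (H / real N) \<partial>?M)"
    by (intro integral_mono int_SUP upper Bochner_Integration.integrable_add int0 int_sum
        P.integrable_const)
  also have "\<dots> = (\<integral>ds. \<bar>Z 0 ds\<bar> \<partial>?M) + (\<integral>ds. (\<Sum>j<N. \<bar>Y j ds\<bar>) \<partial>?M) + 2 * (H / real N)"
    using int0 int_sum by (simp add: P.prob_space)
  also have "\<dots> = (\<integral>ds. \<bar>Z 0 ds\<bar> \<partial>?M) + (\<Sum>j<N. (\<integral>ds. \<bar>Y j ds\<bar> \<partial>?M)) + 2 * (H / real N)"
    by (intro arg_cong2[where f = "(+)"] refl Bochner_Integration.integral_sum intY_abs)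
  also have "\<dots> \<le> B * sqrt (1 / real N) + (\<Sum>j<N. (H / real N) * sqrt (1 / real N))
      + 2 * (H * sqrt (1 / real N))"
  proof (intro add_mono sum_mono mult_left_mono)
    show "(\<integral>ds. \<bar>Z 0 ds\<bar> \<partial>?M) \<le> B * sqrt (1 / real N)"
      unfolding Z_def using H N bound0 meas by (intro expectation_deviation_le(3)) auto
    \<comment> \<open>A number in \<open>[0, 1]\<close> is at most its square root; this brings the
      rounding term to the common rate.\<close>
    have "1 / real N \<le> sqrt (1 / real N)"
      using N by (intro real_le_rsqrt) (simp add: power2_eq_square field_simps)
    from mult_left_mono[OF this, of H] show "H / real N \<le> H * sqrt (1 / real N)"
      using H by simp
  qed (use Y_le in auto)
  also have "\<dots> = (B + 3 * H) * sqrt (1 / real N)"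
    using N by (simp add: algebra_simps)
  finally show "(\<integral>ds. (SUP S\<in>{0..H}. Z S ds) \<partial>?M) \<le> (B + 3 * H) * sqrt (1 / real N)" .
qed

text \<open>The estimation error is the deviation at \<open>\<pi>_hat ds\<close>, plus the empirical
  gap between \<open>\<pi>_hat ds\<close> and \<open>\<pi>_star\<close>, minus the deviation at
  \<open>\<pi>_star\<close>. The first is at most \<open>GE ds\<close>, the second is nonpositive by
  empirical optimality, and the third has mean 0.\<close>

lemma (in prob_space) expectation_estimation_error_le:
  fixes l :: "'p \<Rightarrow> 'a \<Rightarrow> real" and N :: nat and P :: "'p set"
  defines "GE \<equiv> generalization_error M N l P"
  assumes bdd: "\<And>ds. ds \<in> space (iid_samples N M) \<Longrightarrow>
        bdd_above ((\<lambda>\<pi>. risk M l \<pi> - empirical_risk N ds l \<pi>) ` P)"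
    and int_GE: "integrable (iid_samples N M) GE"
    and int: "integrable (iid_samples N M) (\<lambda>ds. risk M l \<pi>_star - empirical_risk N ds l \<pi>_star)"
    and mean: "(\<integral>ds. risk M l \<pi>_star - empirical_risk N ds l \<pi>_star \<partial>iid_samples N M) = 0"
    and hat: "\<And>ds. ds \<in> space (iid_samples N M) \<Longrightarrow>
        is_arg_min (empirical_risk N ds l) (\<lambda>\<pi>. \<pi> \<in> P) (\<pi>_hat ds)"
    and star: "\<pi>_star \<in> P"
  shows "(\<integral>ds. estimation_error M l (\<pi>_hat ds) \<pi>_star \<partial>iid_samples N M)
    \<le> (\<integral>ds. GE ds \<partial>iid_samples N M)"
proof -
  let ?M = "iid_samples N M"
  let ?Z = "\<lambda>\<pi> ds. risk M l \<pi> - empirical_risk N ds l \<pi>"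
  have upper: "?Z \<pi> ds \<le> GE ds" if "\<pi> \<in> P" "ds \<in> space ?M" for \<pi> ds
    unfolding GE_def generalization_error_def by (rule cSUP_upper[OF that(1) bdd[OF that(2)]])
  show ?thesis
  \<comment> \<open>\<open>\<pi>_hat\<close> is an arbitrary selection of empirical minimizers, so
    its risk need not be measurable in the sample.\<close>
  proof (cases "integrable ?M (\<lambda>ds. estimation_error M l (\<pi>_hat ds) \<pi>_star)")
    case True
    have "(\<integral>ds. estimation_error M l (\<pi>_hat ds) \<pi>_star \<partial>?M) \<le> (\<integral>ds. GE ds - ?Z \<pi>_star ds \<partial>?M)"
    proof (rule integral_mono[OF True Bochner_Integration.integrable_diff[OF int_GE int]])
      fix ds assume ds: "ds \<in> space ?M"
      have "\<pi>_hat ds \<in> P" "empirical_risk N ds l (\<pi>_hat ds) \<le> empirical_risk N ds l \<pi>_star"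
        using hat[OF ds] star by (auto simp: is_arg_min_linorder)
      with upper[OF _ ds] show "estimation_error M l (\<pi>_hat ds) \<pi>_star \<le> GE ds - ?Z \<pi>_star ds"
        unfolding estimation_error_def by (smt (verit))
    qed
    also have "\<dots> = (\<integral>ds. GE ds \<partial>?M)"
      using Bochner_Integration.integral_diff[OF int_GE int] mean by simp
    finally show ?thesis .
  next
    case False
    \<comment> \<open>A non-integrable function has integral 0 by convention, so it suffices that
      the mean of \<open>GE\<close> is nonnegative; \<open>GE\<close> dominates a deviation of mean
      0.\<close>
    have "(\<integral>ds. ?Z \<pi>_star ds \<partial>?M) \<le> (\<integral>ds. GE ds \<partial>?M)"
      by (intro integral_mono int int_GE upper star)
    with mean False show ?thesis by (simp add: not_integrable_integral_eq)
  qed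
qed

section \<open>Base-stock policies\<close>

text \<open>The order of period \<open>t - L\<close> moves from the pipeline into the level and
  cancels in the position, which therefore changes only by the new order and the demand.\<close>

lemma inventory_position_Suc:
  assumes "t \<ge> 1"
  shows "inventory_position L x1 \<pi> d (Suc t)
    = inventory_position L x1 \<pi> d t + order_quantity L x1 \<pi> d t - d t"
proof -
  let ?q = "order_quantity L x1 \<pi> d"
  have level: "inventory_level L x1 \<pi> d (Suc t) = inventory_level L x1 \<pi> d t + ?q (t - L) - d t"
    using assms by (cases t) auto
  have "(\<Sum>s\<in>{Suc t - L..<Suc t}. ?q s) + ?q (t - L) = (\<Sum>s\<in>{t - L..<t}. ?q s) + ?q t"
  proof (cases "t < L")
    \<comment> \<open>Truncated subtraction starts both windows at 0 here, and
      \<open>?q 0 = 0\<close> says that nothing arrives yet.\<close>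
    case True
    then show ?thesis by simp
  next
    case False
    then have "Suc t - L = Suc (t - L)" by simp
    then have "(\<Sum>s\<in>{t - L..<Suc t}. ?q s) = ?q (t - L) + (\<Sum>s\<in>{Suc t - L..<Suc t}. ?q s)"
      by (simp only: sum.atLeast_Suc_lessThan[of "t - L" "Suc t"] less_Suc_eq_le diff_le_self)
    moreover have "(\<Sum>s\<in>{t - L..<Suc t}. ?q s) = (\<Sum>s\<in>{t - L..<t}. ?q s) + ?q t"
      by (rule sum.atLeastLessThan_Suc) simp
    ultimately show ?thesis by linarith
  qed
  with level show ?thesis
    unfolding inventory_position.simps[of L x1 \<pi> d t] inventory_position.simps[of L x1 \<pi> d "Suc t"]
    by linarith
qed

lemma inventory_position_first:
  "inventory_position L x1 \<pi> d (Suc 0) = x1"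
  by (cases L) auto

section \<open>Orders and positions under a fixed base-stock level\<close>

lemma order_quantity_base_stock:
  assumes "t \<ge> 1"
  shows "order_quantity L x1 (base_stock S) d t
    = max (S - inventory_position L x1 (base_stock S) d t) 0"
  using assms by (cases t) (auto simp: base_stock_def simp del: inventory_position.simps)

text \<open>Ordering lifts a position below \<open>S\<close> exactly to \<open>S\<close>, and
  nonnegative demand can only lower it afterwards.\<close>

lemma inventory_position_base_stock_le:
  assumes "x1 \<le> S" "\<And>s. s \<in> {1..t} \<Longrightarrow> 0 \<le> d s"
  shows "inventory_position L x1 (base_stock S) d (Suc t) \<le> S"
  using assms(2)
proof (induction t)
  case 0
  then show ?case using assms(1) by (simp only: inventory_position_first)
next
  case (Suc t)
  then have "inventory_position L x1 (base_stock S) d (Suc t) \<le> S" "0 \<le> d (Suc t)" by auto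
  then show ?case
    by (simp add: inventory_position_Suc[of "Suc t"] order_quantity_base_stock
        del: inventory_position.simps order_quantity.simps)
qed

text \<open>As the position never exceeds \<open>S\<close>, the order of period \<open>t\<close>
  restores it exactly to \<open>S\<close>, and only the demand of that period is then
  missing.\<close>

lemma inventory_position_base_stock:
  assumes "x1 \<le> S" "\<And>s. s \<in> {1..t} \<Longrightarrow> 0 \<le> d s" "t \<ge> 1"
  shows "inventory_position L x1 (base_stock S) d (Suc t) = S - d t"
proof -
  have "inventory_position L x1 (base_stock S) d (Suc (t - 1)) \<le> S"
    using assms by (intro inventory_position_base_stock_le) auto
  then have "inventory_position L x1 (base_stock S) d t \<le> S"
    using assms(3) by (simp del: inventory_position.simps)
  then show ?thesis
    using assms(3) by (simp add: inventory_position_Suc order_quantity_base_stock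
        del: inventory_position.simps order_quantity.simps)
qed

lemma order_quantity_base_stock_first:
  assumes "x1 \<le> S"
  shows "order_quantity L x1 (base_stock S) d (Suc 0) = S - x1"
  using assms by (simp only: order_quantity_base_stock inventory_position_first order_refl One_nat_def)

lemma order_quantity_base_stock_later:
  assumes "x1 \<le> S" "\<And>s. s \<in> {1..t} \<Longrightarrow> 0 \<le> d s" "t \<ge> 1"
  shows "order_quantity L x1 (base_stock S) d (Suc t) = d t"
  using assms(2)[of t] assms(3) order_quantity_base_stock[of "Suc t" L x1 S d]
    inventory_position_base_stock[where L = L, OF assms]
  by simp

text \<open>The net level is the position minus the outstanding orders. Each of these equals the
  demand of the period before it, because \<open>t \<ge> L + 1\<close> keeps the first order out of
  the window \<open>{Suc t - L..<Suc t}\<close>.\<close>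

lemma replenished_level_base_stock:
  assumes "x1 \<le> S" "\<And>s. s \<in> {1..t} \<Longrightarrow> 0 \<le> d s" "t \<ge> L + 1"
  shows "replenished_level L x1 (base_stock S) d t - d t = S - (\<Sum>s\<in>{t - L..t}. d s)"
proof -
  let ?q = "order_quantity L x1 (base_stock S) d"
  have "replenished_level L x1 (base_stock S) d t - d t = inventory_level L x1 (base_stock S) d (Suc t)"
    using assms(3) by (cases t) (auto simp: replenished_level_def)
  also have "\<dots> = inventory_position L x1 (base_stock S) d (Suc t) - (\<Sum>s\<in>{Suc t - L..<Suc t}. ?q s)"
    unfolding inventory_position.simps by simp
  also have "inventory_position L x1 (base_stock S) d (Suc t) = S - d t"
    using assms by (intro inventory_position_base_stock) auto
  also have "(\<Sum>s\<in>{Suc t - L..<Suc t}. ?q s) = (\<Sum>s\<in>{t - L..<t}. ?q (Suc s))"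
    using assms(3) sum.shift_bounds_Suc_ivl[of ?q "t - L" t] by (simp add: Suc_diff_le del: order_quantity.simps)
  also have "\<dots> = (\<Sum>s\<in>{t - L..<t}. d s)"
    using assms by (intro sum.cong refl order_quantity_base_stock_later) auto
  also have "S - d t - (\<Sum>s\<in>{t - L..<t}. d s) = S - (\<Sum>s\<in>{t - L..t}. d s)"
    by (simp add: sum.last_plus)
  finally show ?thesis .
qed

text \<open>
  The fixed cost of the order of period 1 is left out: for \<open>x1 = 0\<close> it makes the loss
  discontinuous at \<open>S = 0\<close>.
\<close>

definition base_stock_loss ::
  "real \<Rightarrow> real \<Rightarrow> real \<Rightarrow> nat \<Rightarrow> nat \<Rightarrow> real \<Rightarrow> demand \<Rightarrow> real" where
  "base_stock_loss b h K L T S d =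
     (\<Sum>t = L + 1..T + L. inventory_cost b h (S - (\<Sum>s\<in>{t - L..t}. d s))
        + K * of_bool (t > L + 1 \<and> d (t - L - 1) > 0)) / real T"

text \<open>The order arriving in period \<open>L + 1\<close> is the first one,
  \<open>S - x1\<close>, which does not depend on demand; each later arrival equals the demand
  \<open>d (t - L - 1)\<close>. This separates the possible jump in \<open>S\<close> from the
  Lipschitz part.\<close>

lemma loss_base_stock:
  assumes "x1 \<le> S" "\<And>s. s \<in> {1..T + L} \<Longrightarrow> 0 \<le> d s" "T > 0"
  shows "loss b h K L T x1 (base_stock S) d
    = base_stock_loss b h K L T S d + K * of_bool (S > x1) / real T"
proof -
  let ?a = "\<lambda>t. inventory_cost b h (S - (\<Sum>s\<in>{t - L..t}. d s))
    + K * of_bool (t > L + 1 \<and> d (t - L - 1) > 0)"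
  have "period_loss b h K L x1 (base_stock S) d t = ?a t + (if t = L + 1 then K * of_bool (S > x1) else 0)"
    if t: "t \<in> {L + 1..T + L}" for t
  proof -
    have level: "replenished_level L x1 (base_stock S) d t - d t = S - (\<Sum>s\<in>{t - L..t}. d s)"
      using assms t by (intro replenished_level_base_stock) auto
    show ?thesis
    proof (cases "t = L + 1")
      case True
      then show ?thesis
        using assms(1) order_quantity_base_stock_first[of x1 S L d]
        unfolding period_loss_def level by (simp del: order_quantity.simps)
    next
      case False
      with t have "t - L = Suc (t - L - 1)" "t - L - 1 \<ge> 1" by auto
      moreover have "order_quantity L x1 (base_stock S) d (Suc (t - L - 1)) = d (t - L - 1)"
        using assms t \<open>t - L - 1 \<ge> 1\<close> by (intro order_quantity_base_stock_later) auto
      ultimately have "order_quantity L x1 (base_stock S) d (t - L) = d (t - L - 1)" by metis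
      then show ?thesis using False t unfolding period_loss_def level by simp
    qed
  qed
  then have "(\<Sum>t = L + 1..T + L. period_loss b h K L x1 (base_stock S) d t)
      = (\<Sum>t = L + 1..T + L. ?a t + (if t = L + 1 then K * of_bool (S > x1) else 0))"
    by (rule sum.cong[OF refl])
  \<comment> \<open>\<open>T > 0\<close> puts \<open>L + 1\<close> into the range of summation, so
    the correction is counted exactly once.\<close>
  also have "\<dots> = (\<Sum>t = L + 1..T + L. ?a t) + K * of_bool (S > x1)"
    using assms(3) by (simp only: sum.distrib sum.delta finite_atLeastAtMost) simp
  finally show ?thesis
    unfolding loss_def base_stock_loss_def by (simp only: add_divide_distrib)
qed

section \<open>Lipschitz continuity and boundedness of the base-stock loss\<close>

lemma inventory_cost_Lipschitz:
  assumes "b \<in> {0..1}" "h \<in> {0..1}"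
  shows "\<bar>inventory_cost b h x - inventory_cost b h y\<bar> \<le> \<bar>x - y\<bar>"
proof -
  have aux: "\<bar>inventory_cost b h x - inventory_cost b h y\<bar> \<le> x - y" if "y \<le> x" for x y
  proof -
    \<comment> \<open>Between \<open>y\<close> and \<open>x\<close> the positive part grows by
      \<open>p\<close> and the negative part shrinks by \<open>n\<close>. With rates in
      \<open>[0, 1]\<close> the change \<open>h * p - b * n\<close> lies between \<open>- n\<close>
      and \<open>p\<close>, and \<open>p + n = x - y\<close>.\<close>
    define p where "p = max x 0 - max y 0"
    define n where "n = max (- y) 0 - max (- x) 0"
    have pn: "0 \<le> p" "0 \<le> n" "p + n = x - y" using that unfolding p_def n_def by linarith+
    have "inventory_cost b h x - inventory_cost b h y = h * p - b * n"
      by (simp add: inventory_cost_def p_def n_def algebra_simps)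
    moreover have "0 \<le> h * p" "h * p \<le> p" "0 \<le> b * n" "b * n \<le> n"
      using assms pn by (auto intro: mult_left_le_one_le)
    ultimately show ?thesis using pn by linarith
  qed
  show ?thesis using aux[of y x] aux[of x y] by linarith
qed

text \<open>The fixed-cost terms do not depend on \<open>S\<close> and cancel, leaving an average of
  1-Lipschitz costs.\<close>

lemma base_stock_loss_Lipschitz:
  assumes "b \<in> {0..1}" "h \<in> {0..1}" "T > 0"
  shows "\<bar>base_stock_loss b h K L T S d - base_stock_loss b h K L T S' d\<bar> \<le> \<bar>S - S'\<bar>"
proof -
  let ?c = "\<lambda>S t. inventory_cost b h (S - (\<Sum>s\<in>{t - L..t}. d s))"
  have "\<bar>\<Sum>t = L + 1..T + L. ?c S t - ?c S' t\<bar> \<le> (\<Sum>t = L + 1..T + L. \<bar>S - S'\<bar>)"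
  proof (intro order_trans[OF sum_abs] sum_mono)
    show "\<bar>?c S t - ?c S' t\<bar> \<le> \<bar>S - S'\<bar>" for t
      by (rule order_trans[OF inventory_cost_Lipschitz[OF assms(1,2)]]) simp
  qed
  moreover have "base_stock_loss b h K L T S d - base_stock_loss b h K L T S' d
      = (\<Sum>t = L + 1..T + L. ?c S t - ?c S' t) / real T"
    unfolding base_stock_loss_def diff_divide_distrib[symmetric] sum_subtractf[symmetric] by simp
  ultimately show ?thesis using assms(3) by (simp only: abs_divide) (simp add: divide_le_eq mult.commute)
qed

text \<open>At \<open>S = 0\<close> every net level is minus a sum of \<open>L + 1\<close> demands,
  so only backlog cost arises, at a rate \<open>b \<le> 1\<close>.\<close>

lemma base_stock_loss_zero_bound:
  assumes "b \<in> {0..1}" "K \<ge> 0" "T > 0" "\<And>s. s \<in> {1..T + L} \<Longrightarrow> d s \<in> {0..U}"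
  shows "\<bar>base_stock_loss b h K L T 0 d\<bar> \<le> (real L + 1) * U + K"
proof -
  let ?a = "\<lambda>t. inventory_cost b h (0 - (\<Sum>s\<in>{t - L..t}. d s))
    + K * of_bool (t > L + 1 \<and> d (t - L - 1) > 0)"
  have "\<bar>?a t\<bar> \<le> (real L + 1) * U + K" if t: "t \<in> {L + 1..T + L}" for t
  proof -
    define x where "x = (\<Sum>s\<in>{t - L..t}. d s)"
    have d: "d s \<in> {0..U}" if "s \<in> {t - L..t}" for s using that t by (intro assms(4)) auto
    have "0 \<le> x" unfolding x_def using d by (intro sum_nonneg) auto
    moreover have "x \<le> (\<Sum>s\<in>{t - L..t}. U)" unfolding x_def using d by (intro sum_mono) auto
    moreover have "(\<Sum>s\<in>{t - L..t}. U) = (real L + 1) * U"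
      using t by (simp add: Suc_diff_le)
    moreover have "inventory_cost b h (0 - x) = b * x"
      using \<open>0 \<le> x\<close> by (simp add: inventory_cost_def)
    moreover have "0 \<le> b * x" "b * x \<le> x"
      using assms(1) \<open>0 \<le> x\<close> by (auto intro: mult_left_le_one_le)
    moreover have "0 \<le> K * of_bool (t > L + 1 \<and> d (t - L - 1) > 0)"
      "K * of_bool (t > L + 1 \<and> d (t - L - 1) > 0) \<le> K"
      using assms(2) by auto
    ultimately show ?thesis unfolding x_def[symmetric] by linarith
  qed
  then have "\<bar>\<Sum>t = L + 1..T + L. ?a t\<bar> \<le> (\<Sum>t = L + 1..T + L. (real L + 1) * U + K)"
    by (intro order_trans[OF sum_abs] sum_mono)
  then show ?thesis
    unfolding base_stock_loss_def using assms(3) by (simp add: field_simps)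
qed

section \<open>Measurability in the demand sequence\<close>

lemma measurable_demand:
  assumes "sets D = sets (demand_space U n)" "s \<in> {1..n}"
  shows "(\<lambda>d. d s) \<in> borel_measurable D"
proof -
  have "(\<lambda>d. d s) \<in> measurable (demand_space U n) (restrict_space borel {0..U})"
    unfolding demand_space_def using assms(2) by (rule measurable_component_singleton)
  then have "(\<lambda>d. d s) \<in> borel_measurable (demand_space U n)"
    by (simp add: measurable_restrict_space2_iff)
  then show ?thesis using assms(1) by (simp cong: measurable_cong_sets)
qed

lemma measurable_base_stock_loss:
  assumes "sets D = sets (demand_space U (T + L))"
  shows "base_stock_loss b h K L T S \<in> borel_measurable D"
proof -
  have [measurable]: "(\<lambda>d. inventory_cost b h (S - (\<Sum>s\<in>{t - L..t}. d s))) \<in> borel_measurable D"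
    if "t \<in> {L + 1..T + L}" for t
    unfolding inventory_cost_def using that
    by (intro borel_measurable_add borel_measurable_times borel_measurable_max borel_measurable_const
        borel_measurable_uminus borel_measurable_diff borel_measurable_sum measurable_demand[OF assms]) auto
  have [measurable]: "(\<lambda>d. K * of_bool (t > L + 1 \<and> d (t - L - 1) > 0)) \<in> borel_measurable D"
    if "t \<in> {L + 1..T + L}" for t
  \<comment> \<open>For \<open>t = L + 1\<close> the index \<open>t - L - 1\<close> is 0, which is
    not among the coordinates \<open>{1..T + L}\<close>; the indicator is then constantly
    false.\<close>
  proof (cases "t > L + 1")
    case True
    with that have [measurable]: "(\<lambda>d. d (t - L - 1)) \<in> borel_measurable D"
      by (intro measurable_demand[OF assms]) auto
    show ?thesis by measurable
  qed simp
  show ?thesis unfolding base_stock_loss_def[abs_def]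
    by (intro borel_measurable_divide borel_measurable_sum borel_measurable_add borel_measurable_const) fact+
qed

lemma demand_space_component:
  assumes "sets D = sets (demand_space U n)" "d \<in> space D" "s \<in> {1..n}"
  shows "d s \<in> {0..U}"
  using assms sets_eq_imp_space_eq[OF assms(1)]
  by (auto simp: demand_space_def space_PiM space_restrict_space PiE_iff)

text \<open>The supremum bound is applied to \<open>base_stock_loss\<close> with
  \<open>H + K\<close> for \<open>B\<close>, and carried over to \<open>loss\<close>, which for each
  \<open>S\<close> differs from it by a constant on the demand space.\<close>

lemma base_stock_generalization_bounds:
  fixes b h K U x1 :: real and L T N :: nat and D :: "demand measure"
  assumes bh: "b \<in> {0..1}" "h \<in> {0..1}" and K: "K \<ge> 0" and U: "U > 0" and T: "T > 0"
    and x1: "x1 \<le> 0" and D: "prob_space D" and sets: "sets D = sets (demand_space U (T + L))"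
    and N: "N > 0"
  defines "l \<equiv> loss b h K L T x1" and "P \<equiv> base_stock_policies ((real L + 1) * U)"
    and "M \<equiv> iid_samples N D"
  defines "GE \<equiv> generalization_error D N l P"
  shows "\<And>\<pi>_hat \<pi>_star. (\<And>ds. ds \<in> space M \<Longrightarrow>
          is_arg_min (empirical_risk N ds l) (\<lambda>\<pi>. \<pi> \<in> P) (\<pi>_hat ds)) \<Longrightarrow>
        \<pi>_star \<in> P \<Longrightarrow>
        (\<integral>ds. estimation_error D l (\<pi>_hat ds) \<pi>_star \<partial>M) \<le> (\<integral>ds. GE ds \<partial>M)"
    and "integrable M GE"
    and "(\<integral>ds. GE ds \<partial>M) \<le> 4 * ((real L + 1) * U + K) * sqrt (1 / real N)"
proof -
  interpret prob_space D by (rule D)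
  define H where "H = (real L + 1) * U"
  have H: "H > 0" using U by (simp add: H_def add_nonneg_pos)
  define F where "F = base_stock_loss b h K L T"
  define Z where "Z = (\<lambda>S ds. expectation (F S) - (\<Sum>i=1..N. F S (ds i)) / real N)"
  have F_meas: "F S \<in> borel_measurable D" for S
    unfolding F_def by (rule measurable_base_stock_loss[OF sets])
  have F_lip: "\<bar>F S d - F S' d\<bar> \<le> \<bar>S - S'\<bar>" for S S' d
    unfolding F_def by (rule base_stock_loss_Lipschitz[OF bh T])
  have F_0: "\<bar>F 0 d\<bar> \<le> H + K" if "d \<in> space D" for d
    unfolding F_def H_def
    by (rule base_stock_loss_zero_bound[OF bh(1) K T demand_space_component[OF sets that]])
  note sup_facts = expectation_sup_deviation_le[where F = F, OF H N F_meas F_0 F_lip]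
  have sup_integrable: "integrable M (\<lambda>ds. SUP S\<in>{0..H}. Z S ds)"
    unfolding M_def Z_def by (rule sup_facts(1))
  have sup_bdd: "\<And>ds. ds \<in> space M \<Longrightarrow> bdd_above ((\<lambda>S. Z S ds) ` {0..H})"
    unfolding M_def Z_def by (rule sup_facts(2))
  have Z_integrable: "\<And>S. S \<in> {0..H} \<Longrightarrow> integrable M (Z S)"
    unfolding M_def Z_def by (rule sup_facts(3))
  have Z_mean: "\<And>S. S \<in> {0..H} \<Longrightarrow> (\<integral>ds. Z S ds \<partial>M) = 0"
    unfolding M_def Z_def by (rule sup_facts(4))
  have sup_le: "(\<integral>ds. (SUP S\<in>{0..H}. Z S ds) \<partial>M) \<le> (H + K + 3 * H) * sqrt (1 / real N)"
    unfolding M_def Z_def by (rule sup_facts(5))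
  have l_eq: "l (base_stock S) d = F S d + K * of_bool (S > x1) / real T"
    if "S \<in> {0..H}" "d \<in> space D" for S d
    unfolding l_def F_def using that x1 T demand_space_component[OF sets that(2)]
    by (intro loss_base_stock) auto
  have dev_eq: "risk D l (base_stock S) - empirical_risk N ds l (base_stock S) = Z S ds"
    if S: "S \<in> {0..H}" and ds: "ds \<in> space M" for S ds
  proof -
    \<comment> \<open>For fixed \<open>S\<close> the cost of the first order is the same for every
      demand sequence, so it enters risk and empirical risk equally and cancels.\<close>
    let ?k = "K * of_bool (S > x1) / real T"
    have "integrable D (F S)"
    proof (rule integrable_bounded_on_space[OF F_meas])
      show "\<bar>F S d\<bar> \<le> H + K + \<bar>S - 0\<bar>" if "d \<in> space D" for d
        using F_lip[of S d 0] F_0[OF that] by linarith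
    qed
    moreover have "risk D l (base_stock S) = expectation (\<lambda>d. F S d + ?k)"
      unfolding risk_def using S l_eq by (intro Bochner_Integration.integral_cong) auto
    ultimately have "risk D l (base_stock S) = expectation (F S) + ?k" by (simp add: prob_space)
    moreover have "empirical_risk N ds l (base_stock S) = (\<Sum>i=1..N. F S (ds i) + ?k) / real N"
      unfolding empirical_risk_def using S ds iid_samples_in_space[of ds N D]
      by (intro arg_cong2[where f = "(/)"] sum.cong refl l_eq) (auto simp: M_def)
    then have "empirical_risk N ds l (base_stock S) = (\<Sum>i=1..N. F S (ds i)) / real N + ?k"
      using N by (simp add: sum.distrib add_divide_distrib)
    ultimately show ?thesis by (simp add: Z_def)
  qed
  have P: "P = base_stock ` {0..H}" by (simp add: P_def base_stock_policies_def H_def)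
  \<comment> \<open>Equality of the two images turns the supremum over policies, and its
    boundedness, into one over levels.\<close>
  have dev_image: "(\<lambda>\<pi>. risk D l \<pi> - empirical_risk N ds l \<pi>) ` P = (\<lambda>S. Z S ds) ` {0..H}"
    if "ds \<in> space M" for ds
    unfolding P image_image using dev_eq[OF _ that] by (rule image_cong[OF refl])
  have GE_eq: "GE ds = (SUP S\<in>{0..H}. Z S ds)" if "ds \<in> space M" for ds
    unfolding GE_def generalization_error_def dev_image[OF that] ..
  show int_GE: "integrable M GE"
    using sup_integrable GE_eq by (subst Bochner_Integration.integrable_cong) auto
  have "(\<integral>ds. GE ds \<partial>M) = (\<integral>ds. (SUP S\<in>{0..H}. Z S ds) \<partial>M)"
    using GE_eq by (intro Bochner_Integration.integral_cong) auto
  also have "\<dots> \<le> (H + K + 3 * H) * sqrt (1 / real N)"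
    by (rule sup_le)
  \<comment> \<open>The absolute constant 4 arises here, from
    \<open>4 * H + K \<le> 4 * (H + K)\<close>.\<close>
  also have "\<dots> \<le> 4 * (H + K) * sqrt (1 / real N)"
    using K by (intro mult_right_mono) auto
  finally show "(\<integral>ds. GE ds \<partial>M) \<le> 4 * ((real L + 1) * U + K) * sqrt (1 / real N)"
    unfolding H_def .
  fix \<pi>_hat \<pi>_star
  assume hat: "\<And>ds. ds \<in> space M \<Longrightarrow>
      is_arg_min (empirical_risk N ds l) (\<lambda>\<pi>. \<pi> \<in> P) (\<pi>_hat ds)"
    and star: "\<pi>_star \<in> P"
  from star obtain S where S: "S \<in> {0..H}" "\<pi>_star = base_stock S" unfolding P by auto
  have dev_star: "risk D l \<pi>_star - empirical_risk N ds l \<pi>_star = Z S ds" if "ds \<in> space M" for ds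
    unfolding S(2) by (rule dev_eq[OF S(1) that])
  show "(\<integral>ds. estimation_error D l (\<pi>_hat ds) \<pi>_star \<partial>M) \<le> (\<integral>ds. GE ds \<partial>M)"
    unfolding M_def GE_def
  proof (rule expectation_estimation_error_le)
    show "bdd_above ((\<lambda>\<pi>. risk D l \<pi> - empirical_risk N ds l \<pi>) ` P)"
      if "ds \<in> space (iid_samples N D)" for ds
      using sup_bdd[of ds] dev_image[of ds] that by (simp add: M_def)
    show "integrable (iid_samples N D) (generalization_error D N l P)"
      using int_GE unfolding M_def GE_def .
    show "integrable (iid_samples N D) (\<lambda>ds. risk D l \<pi>_star - empirical_risk N ds l \<pi>_star)"
      using Z_integrable[OF S(1)] dev_star unfolding M_def
      by (subst Bochner_Integration.integrable_cong) auto
    show "(\<integral>ds. risk D l \<pi>_star - empirical_risk N ds l \<pi>_star \<partial>iid_samples N D) = 0"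
      using Z_mean[OF S(1)] dev_star unfolding M_def
      by (subst Bochner_Integration.integral_cong) auto
  qed (use hat star in \<open>auto simp: M_def\<close>)
qed

theorem corollary1:
  "\<exists>C::real. C > 0 \<and>
    (\<forall>(b::real) (h::real) (K::real) (L::nat) (U::real) (T::nat) (x1::real)
      (D :: demand measure) (N::nat).
      b \<in> {0..1} \<longrightarrow> h \<in> {0..1} \<longrightarrow> K \<ge> 0 \<longrightarrow> U > 0 \<longrightarrow> T > 0 \<longrightarrow> x1 \<le> 0 \<longrightarrow>
      prob_space D \<longrightarrow> sets D = sets (demand_space U (T + L)) \<longrightarrow> N > 0 \<longrightarrow>
      (let l = loss b h K L T x1;
           P = base_stock_policies ((real L + 1) * U);
           M = iid_samples N D;
           GE = generalization_error D N l P
       in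
         (\<forall>(\<pi>_hat :: (nat \<Rightarrow> demand) \<Rightarrow> policy) (\<pi>_star :: policy).
            (\<forall>ds\<in>space M. is_arg_min (empirical_risk N ds l) (\<lambda>\<pi>. \<pi> \<in> P) (\<pi>_hat ds)) \<longrightarrow>
            is_arg_min (risk D l) (\<lambda>\<pi>. \<pi> \<in> P) \<pi>_star \<longrightarrow>
            (\<integral>ds. estimation_error D l (\<pi>_hat ds) \<pi>_star \<partial>M) \<le> (\<integral>ds. GE ds \<partial>M)) \<and>
         integrable M GE \<and>
         (\<integral>ds. GE ds \<partial>M) \<le> C * ((real L + 1) * U + K) * sqrt (1 / real N)))"
  unfolding Let_def
proof (intro exI[of _ "4 :: real"] conjI allI impI, goal_cases)
  case 1
  show ?case by simp
next
  case (2 b h K L U T x1 D N \<pi>_hat \<pi>_star)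
  then show ?case by (intro base_stock_generalization_bounds(1)) (simp_all add: is_arg_min_def)
next
  case (3 b h K L U T x1 D N)
  then show ?case by (intro base_stock_generalization_bounds(2))
next
  case (4 b h K L U T x1 D N)
  then show ?case by (intro base_stock_generalization_bounds(3))
qed

end
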